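(* For $n\geq 1$, $a_n(312;213) = 1$.
   Context: $\mathcal{S}_n$ is the set of permutations of $[n]=\{1,\dots,n\}$, written in one-line notation $\pi=\pi_1\pi_2\cdots\pi_n$ with $\pi_i=\pi(i)$. A permutation is cyclic if it consists of exactly one $n$-cycle. For a cyclic $\pi$, its standard cycle notation is $C(\pi)=(c_1,c_2,\dots,c_n)$ with $c_1=1$ and $c_i=\pi_{c_{i-1}}$ for $2\le i\le n$. A sequence of distinct integers $w_1\cdots w_m$ contains a pattern $\sigma\in\mathcal{S}_k$ if there are indices $i_1<\dots<i_k$ with $w_{i_1}\cdots w_{i_k}$ in the same relative order as $\sigma_1\cdots\sigma_k$; otherwise it avoids $\sigma$. For $\sigma,\tau\in\mathcal{S}_3$, $\mathcal{A}_n(\sigma;\tau)$ is the set of cyclic permutations $\pi\in\mathcal{S}_n$ whose one-line notation avoids $\sigma$ and whose cycle notation $C(\pi)$ (as the sequence $c_1c_2\cdots c_n$) avoids $\tau$; $a_n(\sigma;\tau)=|\mathcal{A}_n(\sigma;\tau)|$. *)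

theory Defs
  imports "HOL-Combinatorics.Orbits"
begin

(* Patterns and one-line notations are lists; positions are counted from 0 in lists,
   whereas the values of a permutation range over {1..n}. *)

definition contains_pattern :: "nat list \<Rightarrow> nat list \<Rightarrow> bool" where
  "contains_pattern w \<sigma> \<longleftrightarrow>
     (\<exists>f :: nat \<Rightarrow> nat. strict_mono_on {..<length \<sigma>} f \<and> f ` {..<length \<sigma>} \<subseteq> {..<length w} \<and>
        (\<forall>i<length \<sigma>. \<forall>j<length \<sigma>. w ! f i < w ! f j \<longleftrightarrow> \<sigma> ! i < \<sigma> ! j))"

definition avoids_pattern :: "nat list \<Rightarrow> nat list \<Rightarrow> bool" where
  "avoids_pattern w \<sigma> \<longleftrightarrow> \<not> contains_pattern w \<sigma>"

definition one_line :: "nat \<Rightarrow> (nat \<Rightarrow> nat) \<Rightarrow> nat list" where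
  "one_line n \<pi> = map \<pi> [1..<Suc n]"

(* The entries are c_1 = 1 and c_i = \<pi> (c_{i-1}), that is, c_i is the (i-1)-st iterate of \<pi> at 1. *)
definition cycle_notation :: "nat \<Rightarrow> (nat \<Rightarrow> nat) \<Rightarrow> nat list" where
  "cycle_notation n \<pi> = map (\<lambda>i. (\<pi> ^^ i) 1) [0..<n]"

(* "permutes" forces \<pi> to be the identity outside {1..n}, so each permutation of [n] is
   represented by exactly one function.  "cyclic_on" says that {1..n} is a single orbit. *)
definition cyclic_perms :: "nat \<Rightarrow> (nat \<Rightarrow> nat) set" where
  "cyclic_perms n = {\<pi>. \<pi> permutes {1..n} \<and> cyclic_on \<pi> {1..n}}"

definition avoiders :: "nat \<Rightarrow> nat list \<Rightarrow> nat list \<Rightarrow> (nat \<Rightarrow> nat) set" where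
  "avoiders n \<sigma> \<tau> = {\<pi> \<in> cyclic_perms n.
     avoids_pattern (one_line n \<pi>) \<sigma> \<and> avoids_pattern (cycle_notation n \<pi>) \<tau>}"

definition num_avoiders :: "nat \<Rightarrow> nat list \<Rightarrow> nat list \<Rightarrow> nat" where
  "num_avoiders n \<sigma> \<tau> = card (avoiders n \<sigma> \<tau>)"

end

theory Submission
  imports Defs
begin

text \<open>
  Let \<open>\<pi>\<close> be such a permutation and \<open>k = \<pi> n\<close>. Since \<open>\<pi>\<close> avoids 312, no value above \<open>k\<close> precedes
  a value below \<open>k\<close> in one-line notation, so the values below \<open>k\<close> occupy exactly the positions below
  \<open>k\<close>; that is, \<open>\<pi>\<close> maps \<open>{1..<k}\<close> into itself. As \<open>\<pi>\<close> is cyclic, \<open>k = 1\<close>, so \<open>n\<close> is the last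
  entry of the cycle notation. An earlier descent would form a 213 together with this last entry;
  so the cycle notation is increasing, and \<open>\<pi>\<close> is the cycle \<open>(1, 2, \<dots>, n)\<close>.
\<close>

section \<open>Patterns of length three as conditions on indices\<close>

lemma contains_pattern_3:
  "contains_pattern w [a, b, c] \<longleftrightarrow>
     (\<exists>i j k. i < j \<and> j < k \<and> k < length w \<and>
        (w ! i < w ! j \<longleftrightarrow> a < b) \<and> (w ! j < w ! i \<longleftrightarrow> b < a) \<and>
        (w ! i < w ! k \<longleftrightarrow> a < c) \<and> (w ! k < w ! i \<longleftrightarrow> c < a) \<and>
        (w ! j < w ! k \<longleftrightarrow> b < c) \<and> (w ! k < w ! j \<longleftrightarrow> c < b))"
    (is "?L \<longleftrightarrow> (\<exists>i j k. ?P i j k)")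
proof
  assume ?L
  then obtain f where f: "strict_mono_on {..<3} f" "f ` {..<3} \<subseteq> {..<length w}"
      "\<forall>i<3. \<forall>j<3. w ! f i < w ! f j \<longleftrightarrow> [a, b, c] ! i < [a, b, c] ! j"
    unfolding contains_pattern_def by (auto simp: eval_nat_numeral)
  have "f 0 < f 1" "f 1 < f 2" "f 2 < length w"
    using f(1,2) by (auto simp: strict_mono_on_def image_subset_iff)
  moreover have "w ! f i < w ! f j \<longleftrightarrow> [a, b, c] ! i < [a, b, c] ! j" if "i < 3" "j < 3" for i j
    using f(3) that by blast
  from this[of 0 1] this[of 1 0] this[of 0 2] this[of 2 0] this[of 1 2] this[of 2 1]
  have "(w ! f 0 < w ! f 1 \<longleftrightarrow> a < b) \<and> (w ! f 1 < w ! f 0 \<longleftrightarrow> b < a) \<and>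
        (w ! f 0 < w ! f 2 \<longleftrightarrow> a < c) \<and> (w ! f 2 < w ! f 0 \<longleftrightarrow> c < a) \<and>
        (w ! f 1 < w ! f 2 \<longleftrightarrow> b < c) \<and> (w ! f 2 < w ! f 1 \<longleftrightarrow> c < b)"
    by simp
  ultimately show "\<exists>i j k. ?P i j k" by blast
next
  assume "\<exists>i j k. ?P i j k"
  then obtain i j k where "?P i j k" by blast
  then show ?L
    unfolding contains_pattern_def
    by (intro exI[of _ "\<lambda>m. [i, j, k] ! m"])
       (simp add: strict_mono_on_def image_subset_iff All_less_Suc Ball_def nth_Cons')
qed

text \<open>The two inequalities that put the three entries in order already decide all six
  comparisons.\<close>

lemma avoids_312_iff:
  "avoids_pattern w [3, 1, 2] \<longleftrightarrow>
     (\<forall>i j k. i < j \<and> j < k \<and> k < length w \<longrightarrow> \<not> (w ! j < w ! k \<and> w ! k < w ! i))"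
  unfolding avoids_pattern_def contains_pattern_3 by fastforce

lemma avoids_213_iff:
  "avoids_pattern w [2, 1, 3] \<longleftrightarrow>
     (\<forall>i j k. i < j \<and> j < k \<and> k < length w \<longrightarrow> \<not> (w ! j < w ! i \<and> w ! i < w ! k))"
  unfolding avoids_pattern_def contains_pattern_3 by fastforce

lemma one_line_avoids_312D:
  assumes "avoids_pattern (one_line n \<pi>) [3, 1, 2]" and "1 \<le> i" "i < j" "j < k" "k \<le> n"
  shows "\<not> (\<pi> j < \<pi> k \<and> \<pi> k < \<pi> i)"
proof -
  have nth: "one_line n \<pi> ! (m - 1) = \<pi> m" if "1 \<le> m" "m \<le> n" for m
    using that by (simp add: one_line_def del: upt_Suc)
  have "length (one_line n \<pi>) = n"
    by (simp add: one_line_def)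
  moreover have "i - 1 < j - 1" "j - 1 < k - 1" "k - 1 < n"
    using assms(2-) by auto
  ultimately show ?thesis
    using assms(1)[unfolded avoids_312_iff, rule_format, of "i - 1" "j - 1" "k - 1"] assms(2-)
    using nth[of i] nth[of j] nth[of k] by simp
qed

section \<open>Orbits of cyclic maps\<close>

text \<open>The iterates of \<open>s\<close> before its first return enumerate its orbit without
  repetition, and this orbit is \<open>S\<close>; so the return time
  \<open>funpow_dist1 f s s\<close> equals \<open>card S\<close>.\<close>

lemma cyclic_on_bij_betw_funpow:
  assumes "cyclic_on f S" "s \<in> S"
  shows "bij_betw (\<lambda>i. (f ^^ i) s) {..<card S} S"
proof -
  have S: "S = orbit f s"
    using orbit_cyclic_eq3[OF assms] by simp
  then have s: "s \<in> orbit f s"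
    using assms by simp
  have "bij_betw (\<lambda>i. (f ^^ i) s) {0..<funpow_dist1 f s s} S"
    unfolding bij_betw_def using inj_on_funpow_dist1[OF s] orbit_conv_funpow_dist1[OF s] S by simp
  moreover from this have "card S = funpow_dist1 f s s"
    by (auto dest: bij_betw_same_card)
  ultimately show ?thesis
    by (simp add: lessThan_atLeast0)
qed

text \<open>\<open>S\<close> is the orbit of \<open>t\<close>, and iterating \<open>f\<close> from
  \<open>t\<close> never leaves \<open>T\<close>.\<close>

lemma cyclic_on_subset_invariant:
  assumes "cyclic_on f S" "f ` T \<subseteq> T" "t \<in> T" "t \<in> S"
  shows "S \<subseteq> T"
proof
  fix x assume "x \<in> S"
  then have "x \<in> orbit f t"
    using orbit_cyclic_eq3[OF assms(1,4)] by simp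
  then show "x \<in> T"
    by induction (use assms in auto)
qed

section \<open>The forced shape of an avoider\<close>

lemma cyclic_avoids_312_last:
  assumes "\<pi> \<in> cyclic_perms n" "avoids_pattern (one_line n \<pi>) [3, 1, 2]" "n \<ge> 1"
  shows "\<pi> n = 1"
proof (rule ccontr)
  assume "\<pi> n \<noteq> 1"
  define k where "k = \<pi> n"
  have perm: "\<pi> permutes {1..n}" and cyc: "cyclic_on \<pi> {1..n}"
    using assms(1) by (auto simp: cyclic_perms_def)
  have "k \<in> {1..n}"
    using permutes_in_image[OF perm, of n] assms(3) by (simp add: k_def)
  with \<open>\<pi> n \<noteq> 1\<close> have k: "1 < k" "k \<le> n"
    by (auto simp: k_def)
  define P where "P = {j \<in> {1..n}. \<pi> j < k}"
  have "\<pi> ` P = {1..<k}"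
  proof
    show "\<pi> ` P \<subseteq> {1..<k}"
      using permutes_in_image[OF perm] by (force simp: P_def)
    show "{1..<k} \<subseteq> \<pi> ` P"
    proof
      fix v assume v: "v \<in> {1..<k}"
      then have "v \<in> \<pi> ` {1..n}"
        using permutes_image[OF perm] k by auto
      then show "v \<in> \<pi> ` P"
        using v by (auto simp: P_def)
    qed
  qed
  moreover have "inj_on \<pi> P"
    using permutes_inj[OF perm] by (rule inj_on_subset) simp
  ultimately have card_P: "card P = k - 1"
    by (metis card_atLeastLessThan card_image)
  \<comment> \<open>A bad position \<open>i < k\<close> carries a value above \<open>k\<close>,
    since \<open>k\<close> itself stands at position \<open>n\<close>. A position \<open>j\<close>
    in \<open>P\<close> after \<open>i\<close> would give a 312 at \<open>i\<close>,
    \<open>j\<close>, \<open>n\<close>, so all of \<open>P\<close> lies before \<open>i\<close>. But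
    \<open>P\<close> has \<open>k - 1\<close> elements, and there are only
    \<open>i - 1 < k - 1\<close> such positions.\<close>
  have "\<pi> ` {1..<k} \<subseteq> {1..<k}"
  proof (rule ccontr)
    assume "\<not> \<pi> ` {1..<k} \<subseteq> {1..<k}"
    then obtain i where i: "1 \<le> i" "i < k" "\<pi> i \<notin> {1..<k}"
      unfolding image_subset_iff Ball_def atLeastLessThan_iff by blast
    have "\<pi> i \<noteq> \<pi> n"
      using inj_eq[OF permutes_inj[OF perm], of i n] i k by simp
    moreover have "\<pi> i \<in> {1..n}"
      using permutes_in_image[OF perm, of i] i k by simp
    ultimately have gt: "\<pi> n < \<pi> i"
      using i(3) by (auto simp: k_def)
    have "P \<subseteq> {1..<i}"
    proof
      fix j assume "j \<in> P"
      then have j: "1 \<le> j" "j \<le> n" "\<pi> j < \<pi> n"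
        by (auto simp: P_def k_def)
      then have "j < n"
        by (cases "j = n") auto
      moreover have "j \<noteq> i"
        using j gt by auto
      ultimately show "j \<in> {1..<i}"
        using one_line_avoids_312D[OF assms(2) i(1), of j n] j gt by fastforce
    qed
    from card_mono[OF _ this] card_P i show False
      by simp
  qed
  \<comment> \<open>The invariant set contains 1 because \<open>1 < k\<close>, so it has to cover
    \<open>{1..n}\<close>; yet it misses \<open>n\<close>, as \<open>k \<le> n\<close>.\<close>
  then have "{1..n} \<subseteq> {1..<k}"
    by (rule cyclic_on_subset_invariant[OF cyc, of _ 1]) (use k in simp_all)
  from subsetD[OF this, of n] assms(3) have "n < k"
    by simp
  with k show False by simp
qed

lemma cycle_notation_avoider:
  assumes "\<pi> \<in> avoiders n [3, 1, 2] [2, 1, 3]" "n \<ge> 1"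
  shows "cycle_notation n \<pi> = [1..<Suc n]"
proof -
  define c where "c i = (\<pi> ^^ i) 1" for i
  have cyc: "\<pi> \<in> cyclic_perms n" "cyclic_on \<pi> {1..n}"
    and av: "avoids_pattern (one_line n \<pi>) [3, 1, 2]" "avoids_pattern (cycle_notation n \<pi>) [2, 1, 3]"
    using assms(1) by (auto simp: avoiders_def cyclic_perms_def)
  have bij: "bij_betw c {..<n} {1..n}"
    using cyclic_on_bij_betw_funpow[OF cyc(2), of 1] assms(2) by (simp add: c_def[abs_def])
  then have inj: "i = j" if "c i = c j" "i < n" "j < n" for i j
    using that by (auto simp: bij_betw_def dest: inj_onD)
  have cn: "cycle_notation n \<pi> = map c [0..<n]"
    by (simp add: cycle_notation_def c_def)
  have "n \<in> c ` {..<n}"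
    using bij assms(2) by (simp add: bij_betw_def)
  then obtain d where d: "d < n" "c d = n"
    by auto
  \<comment> \<open>The entry after \<open>n\<close> would be 1, which already stands at index 0;
    hence no index below \<open>n\<close> follows \<open>d\<close>.\<close>
  have "c (Suc d) = c 0"
    using cyclic_avoids_312_last[OF cyc(1) av(1) assms(2)] d by (simp add: c_def)
  with d have last: "Suc d = n"
    using inj[of "Suc d" 0] by fastforce
  \<comment> \<open>An inversion at \<open>i < j\<close> would form a 213 with the final entry
    \<open>c d = n\<close>. The case \<open>j = d\<close> is excluded because \<open>n\<close> is
    the maximum and cannot be the smaller entry.\<close>
  have mono: "c i < c j" if "i < j" "j < n" for i j
  proof (rule ccontr)
    assume "\<not> c i < c j"
    with inj[of i j] that have desc: "c j < c i"
      by fastforce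
    moreover have "c i \<in> {1..n}" "c i \<noteq> c d"
      using bij that last inj[of i d] by (auto simp: bij_betw_def)
    ultimately have "c i < c d"
      using d by auto
    moreover from desc this have "j \<noteq> d" by auto
    ultimately show False
      using av(2)[unfolded avoids_213_iff cn, rule_format, of i j d] that last desc by simp
  qed
  \<comment> \<open>A strictly increasing list is determined by its set of entries.\<close>
  then have "sorted_wrt (<) (cycle_notation n \<pi>)"
    by (simp add: cn sorted_wrt_iff_nth_less)
  moreover have "set (cycle_notation n \<pi>) = set [1..<Suc n]"
    using bij by (auto simp: cn bij_betw_def lessThan_atLeast0 simp del: upt_Suc)
  moreover have "sorted_wrt (<) [1..<Suc n]"
    by (rule sorted_wrt_upt)
  ultimately show ?thesis
    by (intro strict_sorted_equal) simp_all
qed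

section \<open>Existence and uniqueness of the avoider\<close>

text \<open>The cycle (1, 2, ..., n), with 0 and all numbers above \<open>n\<close> fixed as
  \<open>permutes\<close> demands.\<close>

definition full_cycle :: "nat \<Rightarrow> nat \<Rightarrow> nat" where
  "full_cycle n i = (if i = 0 \<or> n < i then i else if i = n then 1 else Suc i)"

lemma funpow_full_cycle:
  "i < n \<Longrightarrow> (full_cycle n ^^ i) (Suc 0) = Suc i"
  by (induction i) (simp_all add: full_cycle_def)

lemma cycle_notation_full_cycle: "cycle_notation n (full_cycle n) = [1..<Suc n]"
  by (rule nth_equalityI)
     (auto simp: cycle_notation_def funpow_full_cycle simp del: upt_Suc)

lemma full_cycle_permutes: "full_cycle n permutes {1..n}"
proof (rule bij_imp_permutes)
  have "{1..n} \<subseteq> full_cycle n ` {1..n}"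
  proof
    fix v assume v: "v \<in> {1..n}"
    show "v \<in> full_cycle n ` {1..n}"
    proof (cases "v = 1")
      case True
      with v show ?thesis by (intro image_eqI[of _ _ n]) (auto simp: full_cycle_def)
    next
      case False
      with v show ?thesis by (intro image_eqI[of _ _ "v - 1"]) (auto simp: full_cycle_def)
    qed
  qed
  moreover have "full_cycle n ` {1..n} \<subseteq> {1..n}"
    by (auto simp: full_cycle_def)
  ultimately have surj: "full_cycle n ` {1..n} = {1..n}"
    by (rule subset_antisym[rotated])
  \<comment> \<open>A surjection of a finite set onto itself is injective.\<close>
  then have "inj_on (full_cycle n) {1..n}"
    by (intro eq_card_imp_inj_on) simp_all
  then show "bij_betw (full_cycle n) {1..n} {1..n}"
    using surj by (rule bij_betw_imageI)
qed (auto simp: full_cycle_def)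

lemma full_cycle_cyclic_on:
  assumes "n \<ge> 1"
  shows "cyclic_on (full_cycle n) {1..n}"
proof (rule cyclic_on_singleI)
  show one: "1 \<in> {1..n}"
    using assms by simp
  have "{1..n} \<subseteq> orbit (full_cycle n) 1"
  proof
    fix v assume "v \<in> {1..n}"
    then have v: "v = (full_cycle n ^^ (v - 1)) 1"
      using funpow_full_cycle[of "v - 1" n] by fastforce
    \<comment> \<open>\<open>orbit\<close> consists of iterates with at least one application, so
      the starting point belongs to it only by a return, here guaranteed for a permutation of a
      finite set.\<close>
    have "1 \<in> orbit (full_cycle n) 1"
      using full_cycle_permutes[of n] by (intro permutation_self_in_orbit)
        (auto simp: permutation_permutes)
    then show "v \<in> orbit (full_cycle n) 1"
      by (subst v) (rule funpow_in_orbit)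
  qed
  with permutes_orbit_subset[OF full_cycle_permutes one]
  show "{1..n} = orbit (full_cycle n) 1"
    by blast
qed

text \<open>The one-line notation is 2 3 ... n 1, where a descent can only end at the last entry,
  leaving none for the 2 of a 312. The cycle notation is increasing and has no descent at
  all.\<close>

lemma full_cycle_avoider:
  assumes "n \<ge> 1"
  shows "full_cycle n \<in> avoiders n [3, 1, 2] [2, 1, 3]"
proof -
  have nth: "one_line n (full_cycle n) ! i = (if Suc i = n then 1 else Suc (Suc i))" if "i < n" for i
    using that by (simp add: one_line_def full_cycle_def del: upt_Suc)
  have len: "length (one_line n (full_cycle n)) = n"
    by (simp add: one_line_def)
  have "avoids_pattern (one_line n (full_cycle n)) [3, 1, 2]"
    unfolding avoids_312_iff len by (auto simp: nth)
  moreover have "avoids_pattern (cycle_notation n (full_cycle n)) [2, 1, 3]"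
    unfolding avoids_213_iff cycle_notation_full_cycle by (auto simp del: upt_Suc)
  ultimately show ?thesis
    using full_cycle_permutes full_cycle_cyclic_on[OF assms]
    by (simp add: avoiders_def cyclic_perms_def)
qed

text \<open>Consecutive entries of the cycle notation give the values of \<open>\<pi>\<close> at all
  of \<open>{1..n}\<close> except the last entry \<open>n\<close>, where \<open>\<pi> n = 1\<close>
  closes the cycle.\<close>

lemma eq_full_cycle:
  assumes "\<pi> permutes {1..n}" "cycle_notation n \<pi> = [1..<Suc n]" "\<pi> n = 1" "n \<ge> 1"
  shows "\<pi> = full_cycle n"
proof
  fix i
  have pow: "(\<pi> ^^ m) 1 = Suc m" if "m < n" for m
    using arg_cong[OF assms(2), of "\<lambda>w. w ! m"] that
    by (simp add: cycle_notation_def del: upt_Suc)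
  consider "i \<notin> {1..n}" | "i = n" | "1 \<le> i" "i < n"
    by fastforce
  then show "\<pi> i = full_cycle n i"
  proof cases
    case 1
    then show ?thesis
      using permutes_not_in[OF assms(1)] by (auto simp: full_cycle_def)
  next
    case 2
    then show ?thesis
      using assms(3,4) by (simp add: full_cycle_def)
  next
    case 3
    then obtain m where "i = Suc m" by (cases i) auto
    with 3 pow[of m] pow[of "Suc m"] show ?thesis
      by (simp add: full_cycle_def)
  qed
qed

theorem theorem3p22:
  fixes n :: nat
  assumes "n \<ge> 1"
  shows "num_avoiders n [3, 1, 2] [2, 1, 3] = 1"
proof -
  have "\<pi> = full_cycle n" if "\<pi> \<in> avoiders n [3, 1, 2] [2, 1, 3]" for \<pi>
  proof (rule eq_full_cycle)
    show "cycle_notation n \<pi> = [1..<Suc n]"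
      using that assms by (rule cycle_notation_avoider)
    show "\<pi> permutes {1..n}" "\<pi> n = 1"
      using that assms cyclic_avoids_312_last
      by (auto simp: avoiders_def cyclic_perms_def)
  qed (rule assms)
  with full_cycle_avoider[OF assms] have "avoiders n [3, 1, 2] [2, 1, 3] = {full_cycle n}"
    by blast
  then show ?thesis
    by (simp add: num_avoiders_def)
qed

end
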